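(* For any $k \in \mathbb N^*$ and $N \in \mathbb N^*$, we have \begin{equation} \mathfrak m _k(N) \leq \mathfrak m _{k+1}(N)\,. \end{equation}
   Context: For $N\in\mathbb N^*=\mathbb N\setminus\{0\}$, let $\mathfrak M(N)$ be the family of arrays $\mathfrak A=(a^n_i)$ with $N$ rows $n=1,\dots,N$, each row being an infinite sequence of real numbers with $a^n_i<a^n_{i+1}$. The spectrum of $\mathfrak A$ is the set of all sums $\lambda=\sum_{n=1}^N a^n_{j_n}$ with $(j_1,\dots,j_N)\in(\mathbb N^* )^N$; the multiplicity $m(\lambda)$ of $\lambda$ is the number of such $N$-tuples representing it. Ordering the spectrum as a non-decreasing sequence $\lambda_1(\mathfrak A)\le\lambda_2(\mathfrak A)\le\dots$ counted with multiplicity, set $m(k,\mathfrak A)=m(\lambda_k(\mathfrak A))$ and $\mathfrak m_k(N)=\sup_{\mathfrak A\in\mathfrak M(N)} m(k,\mathfrak A)$. *)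

theory Defs
  imports Complex_Main "HOL-Library.FuncSet" "HOL-Library.Extended_Nat"
begin

text \<open>
  An array is represented by a function \<open>a\<close>, where \<open>a n i\<close> is the \<open>i\<close>-th entry of row \<open>n\<close>.
  Rows are indexed by \<open>{1..N}\<close>, entries by \<open>{1..}\<close>; values outside this range play no role.
  The rows are not required to be unbounded.
\<close>

definition arrays :: "nat \<Rightarrow> (nat \<Rightarrow> nat \<Rightarrow> real) set" where
  "arrays N = {a. \<forall>n\<in>{1..N}. \<forall>i\<ge>1. a n i < a n (i + 1)}"

definition index_tuples :: "nat \<Rightarrow> (nat \<Rightarrow> nat) set" where
  "index_tuples N = {1..N} \<rightarrow>\<^sub>E {1..}"

definition tuple_sum :: "nat \<Rightarrow> (nat \<Rightarrow> nat \<Rightarrow> real) \<Rightarrow> (nat \<Rightarrow> nat) \<Rightarrow> real" where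
  "tuple_sum N a j = (\<Sum>n=1..N. a n (j n))"

definition spectrum :: "nat \<Rightarrow> (nat \<Rightarrow> nat \<Rightarrow> real) \<Rightarrow> real set" where
  "spectrum N a = tuple_sum N a ` index_tuples N"

text \<open>The set counted here is finite for every array, see \<open>finite_representations\<close> below.\<close>

definition multiplicity :: "nat \<Rightarrow> (nat \<Rightarrow> nat \<Rightarrow> real) \<Rightarrow> real \<Rightarrow> nat" where
  "multiplicity N a x = card {j \<in> index_tuples N. tuple_sum N a j = x}"

text \<open>
  The sequence \<open>l 1 \<le> l 2 \<le> \<dots>\<close> lists the spectrum in non-decreasing order, counted with
  multiplicity: it is the sequence of sums along an enumeration \<open>e\<close> without repetition of
  index tuples. If all rows are unbounded, the last conjunct forces \<open>e\<close> to be
  onto the set of all index tuples. If some row is bounded, the spectrum may have finite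
  accumulation points, in which case no sequence lists all of it in non-decreasing order; the last
  conjunct says that everything not listed comes after everything listed.
\<close>

definition orders_spectrum :: "nat \<Rightarrow> (nat \<Rightarrow> nat \<Rightarrow> real) \<Rightarrow> (nat \<Rightarrow> real) \<Rightarrow> bool" where
  "orders_spectrum N a l \<longleftrightarrow>
     (\<forall>k\<ge>1. l k \<le> l (k + 1)) \<and>
     (\<exists>e :: nat \<Rightarrow> nat \<Rightarrow> nat. inj_on e {1..} \<and> e ` {1..} \<subseteq> index_tuples N \<and>
          (\<forall>k\<ge>1. l k = tuple_sum N a (e k)) \<and>
          (\<forall>j \<in> index_tuples N - e ` {1..}. \<forall>k\<ge>1. l k \<le> tuple_sum N a j))"

text \<open>
  For \<open>N \<ge> 1\<close> and \<open>k \<ge> 1\<close> the described value exists and is unique, see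
  \<open>orders_spectrum_exists\<close> and \<open>orders_spectrum_unique\<close> below.
\<close>

definition eigval :: "nat \<Rightarrow> (nat \<Rightarrow> nat \<Rightarrow> real) \<Rightarrow> nat \<Rightarrow> real" where
  "eigval N a k = (THE x. \<exists>l :: nat \<Rightarrow> real. orders_spectrum N a l \<and> x = l k)"

definition mult_at :: "nat \<Rightarrow> nat \<Rightarrow> (nat \<Rightarrow> nat \<Rightarrow> real) \<Rightarrow> nat" where
  "mult_at N k a = multiplicity N a (eigval N a k)"

text \<open>The supremum is taken in \<^typ>\<open>enat\<close>, so that no boundedness is presupposed.\<close>

definition max_mult :: "nat \<Rightarrow> nat \<Rightarrow> enat" where
  "max_mult k N = (SUP a\<in>arrays N. enat (mult_at N k a))"

lemma nat_mono_subseq: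
  fixes f :: "nat \<Rightarrow> nat"
  shows "\<exists>r :: nat \<Rightarrow> nat. strict_mono r \<and> mono (\<lambda>k. f (r k))"
proof -
  obtain g :: "nat \<Rightarrow> nat" where g: "strict_mono g" "monoseq (\<lambda>n. f (g n))"
    using seq_monosub[of f] by auto
  show ?thesis
  proof (cases "\<forall>m. \<forall>n\<ge>m. f (g m) \<le> f (g n)")
    case True
    then show ?thesis using g(1) by (intro exI[of _ g]) (simp add: mono_def)
  next
    case False
    then have dec: "\<And>m n. m \<le> n \<Longrightarrow> f (g n) \<le> f (g m)"
      using g(2) unfolding monoseq_def by blast
    define v where "v = (LEAST v. \<exists>m. v = f (g m))"
    obtain m where m: "v = f (g m)"
      using LeastI_ex[of "\<lambda>v. \<exists>m. v = f (g m)"] unfolding v_def by auto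
    have low: "v \<le> f (g n)" for n
      unfolding v_def by (rule Least_le) auto
    have "f (g (m + k)) = v" for k
      using low[of "m + k"] dec[of m "m + k"] m by simp
    moreover have "strict_mono (\<lambda>k. g (m + k))"
      using g(1) by (simp add: strict_mono_def)
    ultimately show ?thesis
      by (intro exI[of _ "\<lambda>k. g (m + k)"]) (simp add: mono_def)
  qed
qed

lemma tuple_mono_subseq:
  fixes s :: "nat \<Rightarrow> nat \<Rightarrow> nat"
  assumes "finite I"
  shows "\<exists>r :: nat \<Rightarrow> nat. strict_mono r \<and> (\<forall>n\<in>I. mono (\<lambda>k. s (r k) n))"
  using assms
proof (induction I)
  case empty
  then show ?case by (intro exI[of _ id]) (simp add: strict_mono_def)
next
  case (insert x I)
  then obtain r :: "nat \<Rightarrow> nat" where r: "strict_mono r" "\<forall>n\<in>I. mono (\<lambda>k. s (r k) n)" by blast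
  obtain q :: "nat \<Rightarrow> nat" where q: "strict_mono q" "mono (\<lambda>k. s (r (q k)) x)"
    using nat_mono_subseq[of "\<lambda>k. s (r k) x"] by blast
  have "strict_mono (\<lambda>k. r (q k))" using r(1) q(1) by (simp add: strict_mono_def)
  moreover have "\<forall>n\<in>insert x I. mono (\<lambda>k. s (r (q k)) n)"
    using r(2) q by (auto simp: mono_def strict_mono_less_eq)
  ultimately show ?case by (intro exI[of _ "\<lambda>k. r (q k)"]) simp
qed

lemma row_less:
  assumes "a \<in> arrays N" "n \<in> {1..N}" "1 \<le> i" "i < i'"
  shows "a n i < a n i'"
  using assms(4)
proof (induction i')
  case (Suc i')
  have step: "a n i' < a n (Suc i')" if "1 \<le> i'"
    using assms(1,2) that unfolding arrays_def by auto
  show ?case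
  proof (cases "i = i'")
    case False
    then have "a n i < a n i'" using Suc by simp
    then show ?thesis using step Suc.prems assms(3) False by force
  qed (use step assms(3) in auto)
qed simp

lemma tuple_sum_mono:
  assumes "a \<in> arrays N" "i \<in> index_tuples N" "\<forall>n\<in>{1..N}. i n \<le> j n"
  shows "tuple_sum N a i \<le> tuple_sum N a j"
  unfolding tuple_sum_def
proof (rule sum_mono)
  fix n assume n: "n \<in> {1..N}"
  have "1 \<le> i n" using assms(2) n unfolding index_tuples_def by (auto simp: PiE_iff)
  moreover have "i n \<le> j n" using assms(3) n by blast
  ultimately show "a n (i n) \<le> a n (j n)"
    using row_less[OF assms(1) n, of "i n" "j n"] by (metis order_le_less)
qed

lemma tuple_sum_strict:
  assumes "a \<in> arrays N" "i \<in> index_tuples N" "j \<in> index_tuples N"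
    "\<forall>n\<in>{1..N}. i n \<le> j n" "i \<noteq> j"
  shows "tuple_sum N a i < tuple_sum N a j"
proof -
  obtain n where n: "n \<in> {1..N}" "i n \<noteq> j n"
    using assms(2,3,5) PiE_ext[of i "{1..N}" "\<lambda>_. {1..}" j] unfolding index_tuples_def by blast
  have pos: "1 \<le> i n" if "n \<in> {1..N}" for n
    using assms(2) that unfolding index_tuples_def by (auto simp: PiE_iff)
  show ?thesis
    unfolding tuple_sum_def
  proof (rule sum_strict_mono_ex1)
    show "\<forall>n\<in>{1..N}. a n (i n) \<le> a n (j n)"
      using row_less[OF assms(1)] pos assms(4) by (metis order_le_less)
    show "\<exists>n\<in>{1..N}. a n (i n) < a n (j n)"
      using row_less[OF assms(1) n(1) pos[OF n(1)]] assms(4) n by (metis order_le_less)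
  qed simp
qed

lemma finite_representations:
  assumes "a \<in> arrays N"
  shows "finite {j \<in> index_tuples N. tuple_sum N a j = x}" (is "finite ?S")
proof (rule ccontr)
  assume "infinite ?S"
  then obtain s :: "nat \<Rightarrow> nat \<Rightarrow> nat" where s: "inj s" "range s \<subseteq> ?S"
    by (meson infinite_countable_subset)
  obtain r :: "nat \<Rightarrow> nat" where r: "strict_mono r" "\<forall>n\<in>{1..N}. mono (\<lambda>k. s (r k) n)"
    using tuple_mono_subseq[of "{1..N}" s] by auto
  have "r 0 < r 1" using r(1) by (simp add: strict_mono_def)
  then have "s (r 0) \<noteq> s (r 1)" using s(1) by (metis injD less_irrefl)
  moreover have "\<forall>n\<in>{1..N}. s (r 0) n \<le> s (r 1) n"
    using r(2) by (auto simp: mono_def)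
  ultimately have "tuple_sum N a (s (r 0)) < tuple_sum N a (s (r 1))"
    using tuple_sum_strict[OF assms, of "s (r 0)" "s (r 1)"] s(2) by blast
  moreover have "tuple_sum N a (s (r k)) = x" for k using s(2) by blast
  ultimately show False by simp
qed

lemma tuple_sum_attains_min:
  assumes "a \<in> arrays N" "S \<subseteq> index_tuples N" "S \<noteq> {}"
  shows "\<exists>j\<in>S. \<forall>i\<in>S. tuple_sum N a j \<le> tuple_sum N a i"
proof (rule ccontr)
  assume "\<not> ?thesis"
  then have next_ex: "\<And>j. j \<in> S \<Longrightarrow> \<exists>i. i \<in> S \<and> tuple_sum N a i < tuple_sum N a j"
    by (meson not_le)
  have "\<exists>s. \<forall>k. s k \<in> S \<and> tuple_sum N a (s (Suc k)) < tuple_sum N a (s k)"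
    using dependent_nat_choice[of "\<lambda>_ j. j \<in> S" "\<lambda>_ j i. tuple_sum N a i < tuple_sum N a j"]
      next_ex assms(3) by blast
  then obtain s where s: "\<And>k. s k \<in> S" "\<And>k. tuple_sum N a (s (Suc k)) < tuple_sum N a (s k)"
    by blast
  obtain r :: "nat \<Rightarrow> nat" where r: "strict_mono r" "\<forall>n\<in>{1..N}. mono (\<lambda>k. s (r k) n)"
    using tuple_mono_subseq[of "{1..N}" s] by auto
  have "r 0 < r 1" using r(1) by (simp add: strict_mono_def)
  then have "tuple_sum N a (s (r 1)) < tuple_sum N a (s (r 0))"
    using lift_Suc_mono_less[of "\<lambda>k. - tuple_sum N a (s k)" "r 0" "r 1"] s(2) by simp
  moreover have "tuple_sum N a (s (r 0)) \<le> tuple_sum N a (s (r 1))"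
    using r(2) s(1) assms(2) by (intro tuple_sum_mono[OF assms(1)]) (auto simp: mono_def)
  ultimately show False by simp
qed

lemma infinite_index_tuples:
  assumes "1 \<le> N"
  shows "infinite (index_tuples N)"
proof
  assume fin: "finite (index_tuples N)"
  define f where "f = (\<lambda>i. restrict (\<lambda>_. Suc i) {1..N})"
  have "inj f"
  proof (rule injI)
    fix x y assume "f x = f y"
    then have "f x 1 = f y 1" by simp
    then show "x = y" using assms by (simp add: f_def)
  qed
  moreover have "range f \<subseteq> index_tuples N"
    by (auto simp: f_def index_tuples_def)
  ultimately show False using fin by (meson finite_imageD finite_subset infinite_UNIV_nat)
qed

lemma orders_spectrum_exists:
  assumes "1 \<le> N" "a \<in> arrays N"
  shows "\<exists>l :: nat \<Rightarrow> real. orders_spectrum N a l"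
proof -
  let ?T = "index_tuples N" and ?s = "tuple_sum N a"
  let ?Q = "\<lambda>F F'. \<exists>j\<in>?T - F. F' = insert j F \<and> (\<forall>i\<in>?T - F. ?s j \<le> ?s i)"
  have ex: "\<exists>F'. (finite F' \<and> F' \<subseteq> ?T) \<and> ?Q F F'" if "finite F \<and> F \<subseteq> ?T" for F
  proof -
    have "?T - F \<noteq> {}" using infinite_index_tuples[OF assms(1)] that
      by (metis Diff_eq_empty_iff finite_subset)
    then obtain j where j: "j \<in> ?T - F" "\<forall>i\<in>?T - F. ?s j \<le> ?s i"
      using tuple_sum_attains_min[OF assms(2), of "?T - F"] by blast
    then show ?thesis using that by (intro exI[of _ "insert j F"]) auto
  qed
  obtain F where F: "F 0 = {}" "\<And>k. finite (F k) \<and> F k \<subseteq> ?T" "\<And>k. ?Q (F k) (F (Suc k))"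
  proof -
    have "\<exists>F. \<forall>k. ((finite (F k) \<and> F k \<subseteq> ?T) \<and> (k = 0 \<longrightarrow> F k = {})) \<and> ?Q (F k) (F (Suc k))"
    proof (rule dependent_nat_choice)
      fix F and k :: nat
      assume "(finite F \<and> F \<subseteq> ?T) \<and> (k = 0 \<longrightarrow> F = {})"
      then show "\<exists>F'. ((finite F' \<and> F' \<subseteq> ?T) \<and> (Suc k = 0 \<longrightarrow> F' = {})) \<and> ?Q F F'"
        using ex[of F] by simp
    qed simp
    then obtain F where F: "\<forall>k. ((finite (F k) \<and> F k \<subseteq> ?T) \<and> (k = 0 \<longrightarrow> F k = {})) \<and> ?Q (F k) (F (Suc k))" ..
    show ?thesis
    proof (rule that)
      show "F 0 = {}" using F by simp
      show "finite (F k) \<and> F k \<subseteq> ?T" for k using spec[OF F, of k] by (elim conjE) (rule conjI)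
      show "?Q (F k) (F (Suc k))" for k using spec[OF F, of k] by (rule conjunct2)
    qed
  qed
  obtain d where d': "\<forall>k. d k \<in> ?T - F k \<and> F (Suc k) = insert (d k) (F k)
      \<and> (\<forall>i\<in>?T - F k. ?s (d k) \<le> ?s i)"
    using choice[of "\<lambda>k j. j \<in> ?T - F k \<and> F (Suc k) = insert j (F k)
      \<and> (\<forall>i\<in>?T - F k. ?s j \<le> ?s i)", OF allI, OF F(3)[unfolded Bex_def]] by (elim exE)
  have d: "d k \<in> ?T - F k" "F (Suc k) = insert (d k) (F k)" for k
    using d' by simp_all
  have d3: "?s (d k) \<le> ?s i" if "i \<in> ?T - F k" for k i
    using d' that by blast
  have F_eq: "F k = d ` {..<k}" for k
    by (induction k) (use F(1) d(2) in \<open>auto simp: lessThan_Suc\<close>)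
  have inj: "inj d"
  proof (rule linorder_injI)
    fix x y :: nat assume "x < y"
    then have "d x \<in> F y" using F_eq by auto
    then show "d x \<noteq> d y" using d(1)[of y] by auto
  qed
  define e where "e = (\<lambda>k. d (k - 1))"
  have "inj_on e {1..}"
  proof (rule inj_onI)
    fix x y :: nat assume "x \<in> {1..}" "y \<in> {1..}" "e x = e y"
    moreover from this have "x - 1 = y - 1" using inj by (simp add: e_def inj_eq)
    ultimately show "x = y" by (simp add: eq_diff_iff)
  qed
  moreover have "e ` {1..} \<subseteq> ?T" using d(1) by (auto simp: e_def)
  moreover have "?s (e k) \<le> ?s (e (k + 1))" if "k \<ge> 1" for k
  proof -
    have "d k \<in> ?T - F (k - 1)" using d(1)[of k] F_eq by auto
    then show ?thesis using d3[of "d k" "k - 1"] by (simp add: e_def)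
  qed
  moreover have "?s (e k) \<le> ?s j" if j: "j \<in> ?T - e ` {1..}" and "k \<ge> 1" for j k
  proof -
    have "e (Suc m) = d m" for m by (simp add: e_def)
    then have "d m \<in> e ` {1..}" for m by (metis atLeast_iff image_eqI le_add1 plus_1_eq_Suc)
    then have "j \<in> ?T - F (k - 1)" using j F_eq by auto
    then show ?thesis using d3[of j "k - 1"] by (simp add: e_def)
  qed
  ultimately have "orders_spectrum N a (\<lambda>k. ?s (e k))"
    unfolding orders_spectrum_def by (intro conjI exI[of _ e]) simp_all
  then show ?thesis by (rule exI[of "orders_spectrum N a"])
qed

lemma orders_spectrum_unique:
  assumes "orders_spectrum N a l" "orders_spectrum N a l'" "1 \<le> k"
  shows "l k = l' k"
proof -
  have le: "l' k \<le> l k" if ord: "orders_spectrum N a l" "orders_spectrum N a l'" for l l'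
  proof (rule ccontr)
    assume "\<not> l' k \<le> l k"
    then have less: "l k < l' k" by simp
    have mono: "f i \<le> f m" if "\<forall>k\<ge>1. f k \<le> f (k + 1)" "1 \<le> i" "i \<le> m"
      for f :: "nat \<Rightarrow> real" and i m
      using that(3) by (induction m rule: dec_induct) (use that(1,2) in \<open>auto intro: order_trans\<close>)
    obtain e where e: "inj_on e {1..}" "e ` {1..} \<subseteq> index_tuples N"
        "\<forall>k\<ge>1. l k = tuple_sum N a (e k)" and l: "\<forall>k\<ge>1. l k \<le> l (k + 1)"
      using ord(1) unfolding orders_spectrum_def by blast
    obtain e' where e': "\<forall>k\<ge>1. l' k = tuple_sum N a (e' k)" and l': "\<forall>k\<ge>1. l' k \<le> l' (k + 1)"
        and rest: "\<forall>j \<in> index_tuples N - e' ` {1..}. \<forall>k\<ge>1. l' k \<le> tuple_sum N a j"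
      using ord(2) unfolding orders_spectrum_def by blast
    have "e ` {1..k} \<subseteq> e' ` {1..<k}"
    proof
      fix j assume "j \<in> e ` {1..k}"
      then obtain i where i: "j = e i" "1 \<le> i" "i \<le> k" by auto
      have "tuple_sum N a j \<le> l k" using mono[OF l i(2,3)] e(3) i by simp
      then have lt: "tuple_sum N a j < l' k" using less by simp
      have "j \<in> index_tuples N" using e(2) i by auto
      then obtain m where m: "1 \<le> m" "j = e' m"
        using lt rest assms(3) by (metis DiffI atLeast_iff imageE not_le)
      have "m < k"
        using lt mono[OF l' assms(3), of m] e' m by (metis not_le)
      then show "j \<in> e' ` {1..<k}" using m by auto
    qed
    then have "card (e ` {1..k}) \<le> card {1..<k}"
      by (meson card_image_le card_mono finite_atLeastLessThan finite_imageI order_trans)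
    moreover have "card (e ` {1..k}) = k"
      using card_image[OF inj_on_subset[OF e(1)], of "{1..k}"] by simp
    ultimately show False using assms(3) by simp
  qed
  show ?thesis using le[OF assms(1,2)] le[OF assms(2,1)] by simp
qed

lemma eigval_eq:
  assumes "orders_spectrum N a l" "1 \<le> k"
  shows "eigval N a k = l k"
  unfolding eigval_def
proof (rule the_equality)
  show "\<exists>l' :: nat \<Rightarrow> real. orders_spectrum N a l' \<and> l k = l' k"
    by (rule exI[of _ l]) (simp add: assms(1))
  fix x assume "\<exists>l' :: nat \<Rightarrow> real. orders_spectrum N a l' \<and> x = l' k"
  then obtain l' where "orders_spectrum N a l'" "x = l' k" by (elim exE conjE)
  then show "x = l k" using orders_spectrum_unique[OF _ assms] by simp
qed

lemma eigval_in_spectrum: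
  assumes "1 \<le> N" "a \<in> arrays N" "1 \<le> k"
  shows "eigval N a k \<in> spectrum N a"
proof -
  obtain l where l: "orders_spectrum N a l"
    using orders_spectrum_exists[OF assms(1,2)] by (elim exE)
  then obtain e :: "nat \<Rightarrow> nat \<Rightarrow> nat" where
      "e ` {1..} \<subseteq> index_tuples N" "\<forall>k\<ge>1. l k = tuple_sum N a (e k)"
    unfolding orders_spectrum_def by blast
  then have "l k \<in> spectrum N a" using assms(3) by (auto simp: spectrum_def)
  then show ?thesis using eigval_eq[OF l assms(3)] by simp
qed

end

theory Submission
  imports Defs
begin

text \<open>
  Let \<open>x\<close> be the \<open>k\<close>-th eigenvalue, \<open>\<mu>\<close> the least sum of entries from the rows \<open>2, \<dots>, N\<close>, and insert
  into row 1 a new entry \<open>b\<close> slightly below \<open>x - \<mu>\<close>. Completing \<open>b\<close> by the first entries of the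
  other rows gives a sum below \<open>x\<close>, while every other completion of \<open>b\<close> exceeds \<open>x\<close>. So exactly
  one tuple is added below \<open>x\<close> and none at \<open>x\<close>: the value \<open>x\<close> keeps its multiplicity and becomes
  the eigenvalue of index \<open>k + 1\<close>. Only finitely many sums lie below \<open>x\<close>, hence row 1 has an entry
  above \<open>b\<close> even if it is bounded.
\<close>

section \<open>Characterization of the \<open>k\<close>-th eigenvalue by counting tuples\<close>

definition tuples_below :: "nat \<Rightarrow> (nat \<Rightarrow> nat \<Rightarrow> real) \<Rightarrow> real \<Rightarrow> (nat \<Rightarrow> nat) set" where
  "tuples_below N a x = {j \<in> index_tuples N. tuple_sum N a j < x}"

definition tuples_at :: "nat \<Rightarrow> (nat \<Rightarrow> nat \<Rightarrow> real) \<Rightarrow> real \<Rightarrow> (nat \<Rightarrow> nat) set" where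
  "tuples_at N a x = {j \<in> index_tuples N. tuple_sum N a j = x}"

lemma card_below_at:
  assumes "a \<in> arrays N" "finite (tuples_below N a x)"
  shows "card (tuples_below N a x \<union> tuples_at N a x)
    = card (tuples_below N a x) + card (tuples_at N a x)"
  using assms(2) finite_representations[OF assms(1), of x]
  by (intro card_Un_disjoint) (auto simp: tuples_below_def tuples_at_def)

text \<open>Unlisted tuples and those listed from position \<open>k\<close> on have sum at least
  \<open>x\<close>, so only the first \<open>k - 1\<close> listed tuples can lie below
  \<open>x\<close>. The first \<open>k\<close> listed tuples all have sum at most
  \<open>x\<close>.\<close>

lemma eigval_bounds:
  assumes "1 \<le> N" "a \<in> arrays N" "1 \<le> k"
  defines "x \<equiv> eigval N a k"
  shows "finite (tuples_below N a x)" "card (tuples_below N a x) < k"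
    "k \<le> card (tuples_below N a x) + card (tuples_at N a x)"
proof -
  obtain l where l: "orders_spectrum N a l"
    using orders_spectrum_exists[OF assms(1,2)] by (elim exE)
  have x: "x = l k" unfolding x_def by (rule eigval_eq[OF l assms(3)])
  obtain e where step: "\<forall>k\<ge>1. l k \<le> l (k + 1)"
    and e: "inj_on e {1..}" "e ` {1..} \<subseteq> index_tuples N" "\<forall>k\<ge>1. l k = tuple_sum N a (e k)"
    and rest: "\<forall>j \<in> index_tuples N - e ` {1..}. \<forall>k\<ge>1. l k \<le> tuple_sum N a j"
    using l unfolding orders_spectrum_def by blast
  have mono: "l i \<le> l m" if "1 \<le> i" "i \<le> m" for i m
    using that(2) by (induction m rule: dec_induct) (use step that(1) in \<open>auto intro: order_trans\<close>)
  have below: "tuples_below N a x \<subseteq> e ` {1..<k}"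
  proof
    fix j assume j: "j \<in> tuples_below N a x"
    then have "j \<in> e ` {1..}"
      using rest assms(3) x unfolding tuples_below_def by force
    then obtain m where m: "1 \<le> m" "j = e m" by auto
    then have "l m < l k" using j e(3) x unfolding tuples_below_def by simp
    then have "m < k" using mono[OF assms(3), of m] by (meson not_le)
    then show "j \<in> e ` {1..<k}" using m by auto
  qed
  then show fin: "finite (tuples_below N a x)" by (rule finite_subset) simp
  have "card (tuples_below N a x) \<le> card {1..<k}"
    using surj_card_le[OF _ below] by simp
  then show "card (tuples_below N a x) < k" using assms(3) by simp
  have "e ` {1..k} \<subseteq> tuples_below N a x \<union> tuples_at N a x"
  proof
    fix j assume "j \<in> e ` {1..k}"
    then obtain i where i: "j = e i" "1 \<le> i" "i \<le> k" by auto
    then have "j \<in> index_tuples N" "tuple_sum N a j \<le> x"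
      using e(2,3) mono[of i k] x by auto
    then show "j \<in> tuples_below N a x \<union> tuples_at N a x"
      by (auto simp: tuples_below_def tuples_at_def)
  qed
  moreover have "card (e ` {1..k}) = k"
    using card_image[OF inj_on_subset[OF e(1)], of "{1..k}"] by simp
  moreover have "finite (tuples_below N a x \<union> tuples_at N a x)"
    using fin finite_representations[OF assms(2)] by (simp add: tuples_at_def)
  ultimately show "k \<le> card (tuples_below N a x) + card (tuples_at N a x)"
    unfolding card_below_at[OF assms(2) fin, symmetric] by (metis card_mono)
qed

text \<open>Converse of \<open>eigval_bounds\<close>. For \<open>u < v\<close>, every tuple at or
  below \<open>u\<close> counts as below \<open>v\<close>, so the index ranges that the two bounds
  assign to different values cannot share the index \<open>k\<close>.\<close>

lemma eigval_eqI:
  assumes "1 \<le> N" "a \<in> arrays N" "1 \<le> k"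
    and fin: "finite (tuples_below N a x)" and lt: "card (tuples_below N a x) < k"
    and le: "k \<le> card (tuples_below N a x) + card (tuples_at N a x)"
  shows "eigval N a k = x"
proof -
  let ?y = "eigval N a k"
  have mono: "card (tuples_below N a u) + card (tuples_at N a u) \<le> card (tuples_below N a v)"
    if "u < v" "finite (tuples_below N a v)" for u v
  proof -
    have sub: "tuples_below N a u \<union> tuples_at N a u \<subseteq> tuples_below N a v"
      using that(1) by (auto simp: tuples_below_def tuples_at_def)
    then have "finite (tuples_below N a u)" using that(2) by (meson finite_subset le_sup_iff)
    then show ?thesis
      using card_mono[OF that(2) sub] card_below_at[OF assms(2)] by simp
  qed
  note bounds = eigval_bounds[OF assms(1-3)]
  have "\<not> ?y < x" using mono[of ?y x] fin bounds(3) lt by linarith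
  moreover have "\<not> x < ?y" using mono[of x ?y] bounds(1,2) le by linarith
  ultimately show ?thesis by simp
qed

section \<open>Inserting an entry into row 1\<close>

definition insert_entry :: "nat \<Rightarrow> real \<Rightarrow> (nat \<Rightarrow> nat \<Rightarrow> real) \<Rightarrow> nat \<Rightarrow> nat \<Rightarrow> real" where
  "insert_entry p b a =
     a(1 := (\<lambda>i. if i < p then a 1 i else if i = p then b else a 1 (i - 1)))"

text \<open>Re-indexing that follows each old entry of row 1 to its position in
  \<open>insert_entry p b a\<close>, so that the selected entries, and hence the sum, stay the
  same.\<close>

definition shift_tuple :: "nat \<Rightarrow> (nat \<Rightarrow> nat) \<Rightarrow> nat \<Rightarrow> nat" where
  "shift_tuple p j = j(1 := (if j 1 < p then j 1 else Suc (j 1)))"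

lemma tuple_sum_split:
  assumes "1 \<le> N"
  shows "tuple_sum N a j = a 1 (j 1) + (\<Sum>n=2..N. a n (j n))"
  using sum.atLeast_Suc_atMost[OF assms, of "\<lambda>n. a n (j n)"]
  by (simp add: tuple_sum_def numeral_2_eq_2)

lemma index_tuples_ge_1: "j \<in> index_tuples N \<Longrightarrow> n \<in> {1..N} \<Longrightarrow> 1 \<le> j n"
  by (auto simp: index_tuples_def PiE_iff)

lemma insert_entry_arrays:
  assumes "1 \<le> N" "a \<in> arrays N" "1 \<le> p" "b < a 1 p" "\<And>i. 1 \<le> i \<Longrightarrow> i < p \<Longrightarrow> a 1 i < b"
  shows "insert_entry p b a \<in> arrays N"
  unfolding arrays_def
proof (intro CollectI ballI allI impI)
  fix n i :: nat assume n: "n \<in> {1..N}" and i: "1 \<le> i"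
  note less = row_less[OF assms(2) n]
  show "insert_entry p b a n i < insert_entry p b a n (i + 1)"
  proof (cases "n = 1")
    case True
    consider "i + 1 < p" | "i + 1 = p" | "i = p" | "p < i" by linarith
    then show ?thesis
      by cases (use True i assms(3-5) less in \<open>auto simp: insert_entry_def\<close>)
  qed (use less i in \<open>simp add: insert_entry_def\<close>)
qed

lemma tuple_sum_shift:
  assumes "1 \<le> N"
  shows "tuple_sum N (insert_entry p b a) (shift_tuple p j) = tuple_sum N a j"
  unfolding tuple_sum_split[OF assms] insert_entry_def shift_tuple_def by auto

lemma inj_shift_tuple: "inj (shift_tuple p)"
proof (rule injI)
  fix i j assume eq: "shift_tuple p i = shift_tuple p j"
  have "i n = j n" for n
    using fun_cong[OF eq, of n] by (auto simp: shift_tuple_def split: if_splits)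
  then show "i = j" ..
qed

lemma shift_tuple_image:
  assumes "1 \<le> N" "1 \<le> p"
  shows "shift_tuple p ` index_tuples N = {j \<in> index_tuples N. j 1 \<noteq> p}"
proof (intro equalityI subsetI)
  fix j assume "j \<in> {j \<in> index_tuples N. j 1 \<noteq> p}"
  then have j: "j \<in> index_tuples N" "j 1 \<noteq> p" by auto
  \<comment> \<open>Undoes the shift. If \<open>j 1\<close> is not below \<open>p\<close>, it
    exceeds \<open>p\<close>, so subtracting 1 leaves an index that is still at least
    \<open>p\<close>, hence at least 1.\<close>
  let ?i = "j(1 := (if j 1 < p then j 1 else j 1 - 1))"
  have "?i \<in> index_tuples N"
    using j assms index_tuples_ge_1[OF j(1), of 1] by (auto simp: index_tuples_def PiE_iff extensional_def)
  moreover have "shift_tuple p ?i = j"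
    using j(2) by (auto simp: shift_tuple_def fun_eq_iff)
  ultimately show "j \<in> shift_tuple p ` index_tuples N" by (metis imageI)
next
  fix j assume "j \<in> shift_tuple p ` index_tuples N"
  then show "j \<in> {j \<in> index_tuples N. j 1 \<noteq> p}"
    using assms by (auto simp: shift_tuple_def index_tuples_def PiE_iff extensional_def split: if_splits)
qed

text \<open>Tuples avoiding position \<open>p\<close> in row 1 are exactly the shifted old ones and
  keep their sums. Among the tuples through \<open>p\<close>, only \<open>j0\<close> falls below
  \<open>x\<close> and none hits \<open>x\<close>.\<close>

lemma insert_entry_counts:
  assumes "1 \<le> N" "1 \<le> p" and j0: "j0 \<in> index_tuples N" "j0 1 = p"
    and below: "tuple_sum N (insert_entry p b a) j0 < x"
    and above: "\<And>j. j \<in> index_tuples N \<Longrightarrow> j 1 = p \<Longrightarrow> j \<noteq> j0 \<Longrightarrow>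
      x < tuple_sum N (insert_entry p b a) j"
  shows "tuples_below N (insert_entry p b a) x = insert j0 (shift_tuple p ` tuples_below N a x)"
    "j0 \<notin> shift_tuple p ` tuples_below N a x"
    "tuples_at N (insert_entry p b a) x = shift_tuple p ` tuples_at N a x"
proof -
  let ?a = "insert_entry p b a"
  have split: "index_tuples N = shift_tuple p ` index_tuples N \<union> {j \<in> index_tuples N. j 1 = p}"
    unfolding shift_tuple_image[OF assms(1,2)] by blast
  have not_p: "shift_tuple p j 1 \<noteq> p" for j by (auto simp: shift_tuple_def)
  show "j0 \<notin> shift_tuple p ` tuples_below N a x" using not_p j0(2) by blast
  have Collect_split: "{j \<in> index_tuples N. P (tuple_sum N ?a j)} =
      shift_tuple p ` {j \<in> index_tuples N. P (tuple_sum N a j)} \<union>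
      {j \<in> index_tuples N. j 1 = p \<and> P (tuple_sum N ?a j)}" for P
    by (subst split) (auto simp: tuple_sum_shift[OF assms(1)])
  have "{j \<in> index_tuples N. j 1 = p \<and> tuple_sum N ?a j < x} = {j0}"
    using j0 below above by (auto dest: less_asym)
  then show "tuples_below N ?a x = insert j0 (shift_tuple p ` tuples_below N a x)"
    unfolding tuples_below_def using Collect_split[of "\<lambda>s. s < x"] by simp
  have none: "{j \<in> index_tuples N. j 1 = p \<and> tuple_sum N ?a j = x} = {}"
    using below above by force
  show "tuples_at N ?a x = shift_tuple p ` tuples_at N a x"
    unfolding tuples_at_def using Collect_split[of "\<lambda>s. s = x"] by (simp only: none Un_empty_right)
qed

section \<open>Choice of the new entry and raising the index\<close>

text \<open>Otherwise every entry of row 1, completed by the first entries of the other rows, would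
  give a sum below \<open>x\<close>, and there are infinitely many such tuples.\<close>

lemma row_exceeds:
  assumes "1 \<le> N" "finite (tuples_below N a x)"
  shows "\<exists>i\<ge>1. x - (\<Sum>n=2..N. a n 1) \<le> a 1 i"
proof (rule ccontr)
  assume "\<not> ?thesis"
  then have small: "a 1 i + (\<Sum>n=2..N. a n 1) < x" if "1 \<le> i" for i
    using that by (metis not_le less_diff_eq)
  define f where "f i = restrict (\<lambda>n. if n = 1 then Suc i else 1) {1..N}" for i
  have "tuple_sum N a (f i) = a 1 (Suc i) + (\<Sum>n=2..N. a n 1)" for i
    using assms(1) by (auto simp: tuple_sum_split f_def intro!: sum.cong)
  then have "range f \<subseteq> tuples_below N a x"
    using small by (auto simp: tuples_below_def f_def index_tuples_def)
  moreover have "inj f"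
  proof (rule injI)
    fix u v assume "f u = f v"
    then have "f u 1 = f v 1" by simp
    then show "u = v" using assms(1) by (simp add: f_def)
  qed
  ultimately show False using assms(2) by (meson finite_imageD finite_subset infinite_UNIV_nat)
qed

lemma raise_index:
  assumes "1 \<le> N" "a \<in> arrays N" "1 \<le> k"
  shows "\<exists>a' \<in> arrays N. mult_at N (k + 1) a' = mult_at N k a"
proof -
  define x where "x = eigval N a k"
  note bounds = eigval_bounds[OF assms, folded x_def]
  define \<mu> where "\<mu> = (\<Sum>n=2..N. a n 1)"
  define p where "p = (LEAST i. 1 \<le> i \<and> x - \<mu> \<le> a 1 i)"
  have "\<exists>i. 1 \<le> i \<and> x - \<mu> \<le> a 1 i"
    using row_exceeds[OF assms(1) bounds(1)] unfolding \<mu>_def by blast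
  then have p: "1 \<le> p" "x - \<mu> \<le> a 1 p"
    using LeastI_ex[of "\<lambda>i. 1 \<le> i \<and> x - \<mu> \<le> a 1 i"] unfolding p_def by auto
  have small: "a 1 i < x - \<mu>" if "1 \<le> i" "i < p" for i
    using not_less_Least[of i "\<lambda>i. 1 \<le> i \<and> x - \<mu> \<le> a 1 i"] that unfolding p_def by auto
  \<comment> \<open>Strict lower bounds for \<open>b\<close>. The first set keeps row 1 increasing;
    the second ensures that replacing a first entry by the second one in any other row lifts the sum
    from \<open>b + \<mu>\<close> to above \<open>x\<close>.\<close>
  define L where "L = a 1 ` {1..<p} \<union> (\<lambda>n. x - \<mu> - (a n 2 - a n 1)) ` {2..N}"
  have "\<forall>u\<in>L. u < x - \<mu>"
    using small row_less[OF assms(2), of _ 1 2] by (auto simp: L_def)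
  moreover have "finite L" by (simp add: L_def)
  \<comment> \<open>\<open>L\<close> is empty if \<open>N = 1\<close> and \<open>p = 1\<close>; the
    extra element \<open>x - \<mu> - 1\<close> keeps \<open>Max\<close> meaningful.\<close>
  ultimately have "Max (insert (x - \<mu> - 1) L) < x - \<mu>" by simp
  then obtain b where b: "Max (insert (x - \<mu> - 1) L) < b" "b < x - \<mu>"
    using dense by blast
  then have above_L: "u < b" if "u \<in> L" for u
    using that \<open>finite L\<close> by simp
  define a' where "a' = insert_entry p b a"
  have a': "a' \<in> arrays N"
    unfolding a'_def using p b(2) above_L
    by (intro insert_entry_arrays[OF assms(1,2)]) (auto simp: L_def)
  have sum': "tuple_sum N a' j = b + (\<Sum>n=2..N. a n (j n))" if "j 1 = p" for j :: "nat \<Rightarrow> nat"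
    using that unfolding tuple_sum_split[OF assms(1)] a'_def insert_entry_def
    by (auto intro!: sum.cong)
  define j0 where "j0 = restrict (\<lambda>n. if n = 1 then p else 1) {1..N}"
  have j0: "j0 \<in> index_tuples N" "j0 1 = p"
    using assms(1) p(1) by (auto simp: j0_def index_tuples_def)
  have "(\<Sum>n=2..N. a n (j0 n)) = \<mu>" unfolding \<mu>_def j0_def by (intro sum.cong) auto
  then have below: "tuple_sum N a' j0 < x" using sum'[of j0] j0(2) b(2) by simp
  have above: "x < tuple_sum N a' j" if j: "j \<in> index_tuples N" "j 1 = p" "j \<noteq> j0" for j
  proof -
    obtain m where m: "m \<in> {1..N}" "j m \<noteq> j0 m"
      using j(1,3) j0(1) PiE_ext[of j "{1..N}" "\<lambda>_. {1..}" j0] unfolding index_tuples_def by blast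
    \<comment> \<open>Both tuples take position \<open>p\<close> in row 1, so they differ in a later
      row, where \<open>j0\<close> selects the first entry.\<close>
    then have m2: "m \<in> {2..N}" "2 \<le> j m"
      using j(2) j0(2) index_tuples_ge_1[OF j(1) m(1)]
      by (cases "m = 1"; force simp: j0_def)+
    have le: "a n i \<le> a n i'" if "n \<in> {1..N}" "1 \<le> i" "i \<le> i'" for n i i'
      using row_less[OF assms(2) that(1,2)] that(3) by (metis order_le_less)
    have "(\<Sum>n\<in>{2..N} - {m}. a n 1) \<le> (\<Sum>n\<in>{2..N} - {m}. a n (j n))"
      using index_tuples_ge_1[OF j(1)] by (intro sum_mono le) auto
    moreover have "a m 2 \<le> a m (j m)" using m m2 by (intro le) auto
    moreover have "x - \<mu> - (a m 2 - a m 1) < b" using m2 by (intro above_L) (auto simp: L_def)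
    \<comment> \<open>Row \<open>m\<close> contributes at least \<open>a m 2\<close> and each other
      later row at least its first entry, so the sum is at least
      \<open>b + \<mu> + (a m 2 - a m 1)\<close>, which exceeds \<open>x\<close>.\<close>
    ultimately show ?thesis
      unfolding sum'[of j, OF j(2)] using m2(1)
      by (simp add: \<mu>_def sum.remove[of "{2..N}" m])
  qed
  note counts = insert_entry_counts[OF assms(1) p(1) j0 below[unfolded a'_def] above[unfolded a'_def], folded a'_def]
  have card_shift: "card (shift_tuple p ` A) = card A" for A
    using card_image[OF inj_on_subset[OF inj_shift_tuple]] by blast
  have at: "card (tuples_at N a' x) = card (tuples_at N a x)"
    using counts(3) card_shift by simp
  have "card (tuples_below N a' x) = Suc (card (tuples_below N a x))"
    using counts(1,2) card_shift bounds(1) by simp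
  \<comment> \<open>One more tuple lies below \<open>x\<close> and equally many lie at
    \<open>x\<close>, so both bounds for \<open>k\<close> move up to \<open>k + 1\<close>.\<close>
  then have "eigval N a' (k + 1) = x"
    using bounds at counts(1) by (intro eigval_eqI[OF assms(1) a']) auto
  then have "mult_at N (k + 1) a' = mult_at N k a"
    using at by (simp add: mult_at_def multiplicity_def tuples_at_def x_def)
  then show ?thesis using a' by blast
qed

theorem theorem1p3:
  fixes k N :: nat
  assumes "k \<ge> 1" and "N \<ge> 1"
  shows "max_mult k N \<le> max_mult (k + 1) N"
  unfolding max_mult_def
proof (rule SUP_mono)
  fix a assume "a \<in> arrays N"
  then show "\<exists>a'\<in>arrays N. enat (mult_at N k a) \<le> enat (mult_at N (k + 1) a')"
    using raise_index[OF assms(2) _ assms(1)] by (metis order_refl)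
qed

end
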